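(* Let $U_2=\{L(\alpha)\in CE(\mu_6): b_{1,1}\neq 0,\ b_{1,4}=0,\ b_{1,2}\neq 0\}$, and for $\alpha=(b_{0,0},b_{0,1},b_{1,1},b_{1,2},b_{1,4})$ put $\Delta=b_{0,1}^2-4b_{0,0}b_{1,1}$ (and $\Delta'=b_{0,1}'^2-4b_{0,0}'b_{1,1}'$ for $\alpha'$). (1) Two algebras $L(\alpha)$ and $L(\alpha')$ from $U_2$ are isomorphic if and only if $$\left(\frac{b_{1,2}}{b_{1,1}}\right)^8\Delta=\left(\frac{b_{1,2}'}{b_{1,1}'}\right)^8\Delta'.$$ (2) For any $\lambda\in\mathbb{C}$ there exists $L(\alpha)\in U_2$ with $\left(\frac{b_{1,2}}{b_{1,1}}\right)^8\Delta=\lambda$. Then the algebras from $U_2$ can be parameterized as $L(\lambda,0,1,1,0)$, $\lambda\in\mathbb{C}$; that is, every algebra in $U_2$ is isomorphic to $L(\lambda,0,1,1,0)$ for some $\lambda\in\mathbb{C}$.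
   Context: A Leibniz algebra over $\mathbb{C}$ is a complex vector space with a bilinear bracket satisfying $[x,[y,z]]=[[x,y],z]-[[x,z],y]$. $CE(\mu_6)$ (one-dimensional Leibniz central extensions of the 6-dimensional naturally graded filiform Lie algebra $\mu_6$) is the class of the 7-dimensional complex Leibniz algebras $L(\alpha)$, $\alpha=(b_{0,0},b_{0,1},b_{1,1},b_{1,2},b_{1,4})\in\mathbb{C}^5$, with basis $e_0,\dots,e_6$ and brackets $[e_i,e_0]=e_{i+1}$ ($1\le i\le 5$), $[e_0,e_i]=-e_{i+1}$ ($2\le i\le 5$), $[e_0,e_0]=b_{0,0}e_6$, $[e_0,e_1]=-e_2+b_{0,1}e_6$, $[e_1,e_1]=b_{1,1}e_6$, $[e_1,e_2]=-[e_2,e_1]=b_{1,2}e_6$, $[e_1,e_4]=-[e_4,e_1]=b_{1,4}e_6$, $[e_2,e_3]=-[e_3,e_2]=-b_{1,4}e_6$, all other brackets of basis vectors being zero. Isomorphic means isomorphic as Leibniz algebras. *)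

theory Defs
  imports "HOL-Analysis.Analysis"
begin

locale leibniz_algebra = vector_space scale
  for scale :: "complex \<Rightarrow> 'a::ab_group_add \<Rightarrow> 'a" +
  fixes bracket :: "'a \<Rightarrow> 'a \<Rightarrow> 'a"
  assumes linear_left: "Vector_Spaces.linear scale scale (\<lambda>x. bracket x y)"
    and linear_right: "Vector_Spaces.linear scale scale (\<lambda>y. bracket x y)"
    and leibniz: "bracket x (bracket y z) = bracket (bracket x y) z - bracket (bracket x z) y"

definition leibniz_isomorphic ::
    "(complex \<Rightarrow> 'a::ab_group_add \<Rightarrow> 'a) \<Rightarrow> ('a \<Rightarrow> 'a \<Rightarrow> 'a) \<Rightarrow>
     (complex \<Rightarrow> 'b::ab_group_add \<Rightarrow> 'b) \<Rightarrow> ('b \<Rightarrow> 'b \<Rightarrow> 'b) \<Rightarrow> bool" where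
  "leibniz_isomorphic s1 br1 s2 br2 \<longleftrightarrow>
     leibniz_algebra s1 br1 \<and> leibniz_algebra s2 br2 \<and>
     (\<exists>f. Vector_Spaces.linear s1 s2 f \<and> bij f \<and> (\<forall>x y. f (br1 x y) = br2 (f x) (f y)))"

(* Arithmetic in the index type 7 is modulo 7, so e is only meaningful for i \<le> 6. *)
definition e :: "nat \<Rightarrow> complex ^ 7" where
  "e i = axis (of_nat i) 1"

(* The product of the basis vectors e i and e j, for i, j \<le> 6. *)
definition basis_bracket ::
    "complex \<Rightarrow> complex \<Rightarrow> complex \<Rightarrow> complex \<Rightarrow> complex \<Rightarrow> nat \<Rightarrow> nat \<Rightarrow> complex ^ 7" where
  "basis_bracket b00 b01 b11 b12 b14 i j =
    (if 1 \<le> i \<and> i \<le> 5 \<and> j = 0 then e (i + 1)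
     else if i = 0 \<and> 2 \<le> j \<and> j \<le> 5 then - e (j + 1)
     else if i = 0 \<and> j = 0 then b00 *s e 6
     else if i = 0 \<and> j = 1 then - e 2 + b01 *s e 6
     else if i = 1 \<and> j = 1 then b11 *s e 6
     else if i = 1 \<and> j = 2 then b12 *s e 6
     else if i = 2 \<and> j = 1 then - (b12 *s e 6)
     else if i = 1 \<and> j = 4 then b14 *s e 6
     else if i = 4 \<and> j = 1 then - (b14 *s e 6)
     else if i = 2 \<and> j = 3 then - (b14 *s e 6)
     else if i = 3 \<and> j = 2 then b14 *s e 6
     else 0)"

(* An algebra with underlying space complex ^ 7 is identified with its bracket;
   L is the bilinear extension of basis_bracket. *)
definition L ::
    "complex \<Rightarrow> complex \<Rightarrow> complex \<Rightarrow> complex \<Rightarrow> complex \<Rightarrow>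
     complex ^ 7 \<Rightarrow> complex ^ 7 \<Rightarrow> complex ^ 7" where
  "L b00 b01 b11 b12 b14 x y =
    (\<Sum>i\<le>6. \<Sum>j\<le>6. (x $ of_nat i * y $ of_nat j) *s basis_bracket b00 b01 b11 b12 b14 i j)"

definition CE_mu6 :: "(complex ^ 7 \<Rightarrow> complex ^ 7 \<Rightarrow> complex ^ 7) set" where
  "CE_mu6 = {L b00 b01 b11 b12 b14 | b00 b01 b11 b12 b14. True}"

definition U2 :: "(complex ^ 7 \<Rightarrow> complex ^ 7 \<Rightarrow> complex ^ 7) set" where
  "U2 = {L b00 b01 b11 b12 b14 | b00 b01 b11 b12 b14.
           L b00 b01 b11 b12 b14 \<in> CE_mu6 \<and> b11 \<noteq> 0 \<and> b14 = 0 \<and> b12 \<noteq> 0}"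

definition Delta :: "complex \<Rightarrow> complex \<Rightarrow> complex \<Rightarrow> complex" where
  "Delta b00 b01 b11 = b01\<^sup>2 - 4 * b00 * b11"

lemma sum_atMost_6: "(\<Sum>i\<le>6::nat. f i) = f 0 + f 1 + f 2 + f 3 + f 4 + f 5 + (f 6 :: 'a::comm_monoid_add)"
  by (simp add: eval_nat_numeral add.assoc)

lemma e_nth: "e i $ k = (if k = of_nat i then 1 else 0)"
  by (simp add: e_def axis_def)

lemma e_Suc:
  "e (Suc (Suc 0)) = e 2" "e (Suc (Suc (Suc 0))) = e 3"
  "e (Suc (Suc (Suc (Suc 0)))) = e 4" "e (Suc (Suc (Suc (Suc (Suc 0))))) = e 5"
  "e (Suc (Suc (Suc (Suc (Suc (Suc 0)))))) = e 6"
  by (simp_all add: eval_nat_numeral)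

lemma L_expand:
  "L b00 b01 b11 b12 b14 x y =
    (x$1 * y$0 - x$0 * y$1) *s e 2 + (x$2 * y$0 - x$0 * y$2) *s e 3
    + (x$3 * y$0 - x$0 * y$3) *s e 4 + (x$4 * y$0 - x$0 * y$4) *s e 5
    + (x$5 * y$0 - x$0 * y$5 + b00 * (x$0 * y$0) + b01 * (x$0 * y$1) + b11 * (x$1 * y$1)
       + b12 * (x$1 * y$2 - x$2 * y$1) + b14 * (x$1 * y$4 - x$4 * y$1 - x$2 * y$3 + x$3 * y$2)) *s e 6"
  unfolding L_def sum_atMost_6
  by (simp add: basis_bracket_def e_Suc vec_eq_iff algebra_simps)

lemma L_basis:
  assumes "i \<le> 6" "j \<le> 6"
  shows "L b00 b01 b11 b12 b14 (e i) (e j) = basis_bracket b00 b01 b11 b12 b14 i j"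
proof -
  have "i = 0 \<or> i = 1 \<or> i = 2 \<or> i = 3 \<or> i = 4 \<or> i = 5 \<or> i = 6"
    and "j = 0 \<or> j = 1 \<or> j = 2 \<or> j = 3 \<or> j = 4 \<or> j = 5 \<or> j = 6"
    using assms by linarith+
  then show ?thesis
    by (elim disjE; hypsubst;
        simp add: L_expand basis_bracket_def e_nth e_Suc)
qed

lemma leibniz_algebra_L: "leibniz_algebra (*s) (L b00 b01 b11 b12 b14)"
proof -
  let ?L = "L b00 b01 b11 b12 b14"
  have "Vector_Spaces.linear (*s) (*s) (\<lambda>x. ?L x y)" for y
    by unfold_locales (simp_all add: L_expand vec_eq_iff algebra_simps)
  moreover have "Vector_Spaces.linear (*s) (*s) (\<lambda>y. ?L x y)" for x
    by unfold_locales (simp_all add: L_expand vec_eq_iff algebra_simps)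
  moreover have "?L x (?L y z) = ?L (?L x y) z - ?L (?L x z) y" for x y z
    apply (simp add: L_expand e_nth)
    apply (simp add: vec_eq_iff)
    apply (simp add: algebra_simps)
    done
  ultimately show ?thesis
    by (simp add: leibniz_algebra_def leibniz_algebra_axioms_def vec.vector_space_axioms)
qed

end

theory Submission
  imports Defs
begin

text \<open>
  When \<open>b14 = b14' = 0\<close>, an isomorphism is determined up to irrelevant terms by its leading
  coefficients: \<open>e 0\<close> goes to \<open>p e 0 + q e 1 + \<dots>\<close> and \<open>e 1\<close> to \<open>r e 1 + \<dots>\<close>, where \<open>e 0\<close> does not
  occur in the image of \<open>e 1\<close> because \<open>[e 1, e 2]\<close> is a multiple of \<open>e 6\<close>. Then \<open>e 6\<close> goes to
  \<open>p^5 r e 6\<close>, and comparing the \<open>e 6\<close>-coefficients of the remaining brackets yields a transformation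
  law for a binary quadratic form (whose discriminant is \<open>Delta\<close>) together with
  \<open>b12 p^4 = b12' r\<close>. As \<open>[e 1, e 1]\<close> gives \<open>b11 p^5 = b11' r\<close>, we get
  \<open>p = (b12 / b11) / (b12' / b11')\<close>, while the discriminants satisfy \<open>p^8 Delta = Delta'\<close>.
\<close>

lemma exhaust_7:
  fixes k :: 7
  obtains "k = 0" | "k = 1" | "k = 2" | "k = 3" | "k = 4" | "k = 5" | "k = 6"
proof (cases k)
  case (of_int z)
  then have "z = 0 \<or> z = 1 \<or> z = 2 \<or> z = 3 \<or> z = 4 \<or> z = 5 \<or> z = 6" by auto
  then show ?thesis using of_int that by auto
qed

lemma vec_7_eq_iff:
  fixes x y :: "'a ^ 7"
  shows "x = y \<longleftrightarrow> x$0 = y$0 \<and> x$1 = y$1 \<and> x$2 = y$2 \<and> x$3 = y$3 \<and> x$4 = y$4 \<and> x$5 = y$5 \<and> x$6 = y$6"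
    (is "_ \<longleftrightarrow> ?eqs")
proof
  assume eqs: ?eqs
  have "x $ k = y $ k" for k
    by (cases k rule: exhaust_7) (simp_all only: eqs)
  then show "x = y" by (simp add: vec_eq_iff)
qed simp

lemma L_nth:
  "L b00 b01 b11 b12 b14 x y $ 0 = 0"
  "L b00 b01 b11 b12 b14 x y $ 1 = 0"
  "L b00 b01 b11 b12 b14 x y $ 2 = x$1 * y$0 - x$0 * y$1"
  "L b00 b01 b11 b12 b14 x y $ 3 = x$2 * y$0 - x$0 * y$2"
  "L b00 b01 b11 b12 b14 x y $ 4 = x$3 * y$0 - x$0 * y$3"
  "L b00 b01 b11 b12 b14 x y $ 5 = x$4 * y$0 - x$0 * y$4"
  "L b00 b01 b11 b12 b14 x y $ 6 = x$5 * y$0 - x$0 * y$5 + b00 * (x$0 * y$0) + b01 * (x$0 * y$1)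
     + b11 * (x$1 * y$1) + b12 * (x$1 * y$2 - x$2 * y$1)
     + b14 * (x$1 * y$4 - x$4 * y$1 - x$2 * y$3 + x$3 * y$2)"
  by (simp_all add: L_expand e_nth)

text \<open>\<open>U2\<close> is a set of brackets, so conditions on parameters can be read off
  membership only because the \<open>e 6\<close>-coefficients of products of basis vectors recover
  every parameter.\<close>

lemma L_inject:
  assumes "L b00 b01 b11 b12 b14 = L c00 c01 c11 c12 c14"
  shows "b00 = c00" "b01 = c01" "b11 = c11" "b12 = c12" "b14 = c14"
proof -
  have eq: "L b00 b01 b11 b12 b14 (e i) (e j) $ 6 = L c00 c01 c11 c12 c14 (e i) (e j) $ 6" for i j
    using assms by simp
  show "b00 = c00" "b01 = c01" "b11 = c11" "b12 = c12" "b14 = c14"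
    using eq[of 0 0] eq[of 0 1] eq[of 1 1] eq[of 1 2] eq[of 1 4]
    by (simp_all add: L_nth e_nth)
qed

lemma L_in_U2_iff:
  "L b00 b01 b11 b12 b14 \<in> U2 \<longleftrightarrow> b11 \<noteq> 0 \<and> b14 = 0 \<and> b12 \<noteq> 0"
proof
  assume "L b00 b01 b11 b12 b14 \<in> U2"
  then obtain c00 c01 c11 c12 where eq: "L b00 b01 b11 b12 b14 = L c00 c01 c11 c12 0"
    and "c11 \<noteq> 0" "c12 \<noteq> 0"
    unfolding U2_def by blast
  then show "b11 \<noteq> 0 \<and> b14 = 0 \<and> b12 \<noteq> 0"
    using L_inject(3-5)[OF eq] by simp
next
  assume "b11 \<noteq> 0 \<and> b14 = 0 \<and> b12 \<noteq> 0"
  then show "L b00 b01 b11 b12 b14 \<in> U2"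
    unfolding U2_def CE_mu6_def by blast
qed

text \<open>Since \<open>[x, x] = Q(x$0, x$1) e 6\<close> with
  \<open>Q(X, Y) = b00 X^2 + b01 X Y + b11 Y^2\<close>, the first three equations compare
  coefficients in \<open>p^5 r Q(X, Y) = Q'(p X, q X + r Y)\<close>, the last two of them after
  division by \<open>r\<close>.\<close>

lemma L_isomorphic_imp_params:
  assumes "leibniz_isomorphic (*s) (L b00 b01 b11 b12 0) (*s) (L c00 c01 c11 c12 0)"
  obtains p q r where "p \<noteq> 0" "r \<noteq> 0"
    "b00 * p^5 * r = c00 * p^2 + c01 * p * q + c11 * q^2"
    "b01 * p^5 = c01 * p + 2 * c11 * q" "b11 * p^5 = c11 * r" "b12 * p^4 = c12 * r"
proof -
  let ?L = "L b00 b01 b11 b12 0" and ?M = "L c00 c01 c11 c12 0"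
  obtain f where lin: "Vector_Spaces.linear (*s) (*s) f" and bij: "bij f"
    and hom: "f (?L x y) = ?M (f x) (f y)" for x y
    using assms unfolding leibniz_isomorphic_def by blast
  define u v where "u = f (e 0)" and "v = f (e 1)"
  \<comment> \<open>The \<open>e 2\<close>-coefficient of \<open>[v, u]\<close>. Each further right
    multiplication by \<open>u\<close> shifts the leading term by one index and multiplies its
    coefficient by \<open>u$0\<close>.\<close>
  define D where "D = v$1 * u$0 - v$0 * u$1"
  have basis: "?L (e 1) (e 0) = e 2" "?L (e 2) (e 0) = e 3" "?L (e 3) (e 0) = e 4"
    "?L (e 4) (e 0) = e 5" "?L (e 5) (e 0) = e 6"
    "?L (e 0) (e 0) = b00 *s e 6" "?L (e 1) (e 1) = b11 *s e 6" "?L (e 1) (e 2) = b12 *s e 6"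
    \<comment> \<open>Symmetrizing cancels \<open>e 2\<close> and leaves a multiple of
      \<open>e 6\<close>, whose image is under control.\<close>
    and basis_sym: "?L (e 0) (e 1) + ?L (e 1) (e 0) = b01 *s e 6"
    by (simp_all add: vec_7_eq_iff L_nth e_nth)
  have f_add: "f (x + y) = f x + f y" and f_scale: "f (c *s x) = c *s f x" for x y c
    using vec.linear_add[OF lin] vec.linear_scale[OF lin] by auto
  have f2: "f (e 2) = ?M v u" and f3: "f (e 3) = ?M (f (e 2)) u" and f4: "f (e 4) = ?M (f (e 3)) u"
    and f5: "f (e 5) = ?M (f (e 4)) u" and f6: "f (e 6) = ?M (f (e 5)) u"
    unfolding u_def v_def by (simp_all only: basis flip: hom)
  have f2_nth: "f (e 2) $ 0 = 0" "f (e 2) $ 1 = 0" "f (e 2) $ 2 = D"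
    by (simp_all add: f2 L_nth D_def)
  have f3_nth: "f (e 3) $ 0 = 0" "f (e 3) $ 1 = 0" "f (e 3) $ 2 = 0" "f (e 3) $ 3 = D * u$0"
    by (simp_all add: f3 L_nth f2_nth)
  have f4_nth: "f (e 4) $ 0 = 0" "f (e 4) $ 1 = 0" "f (e 4) $ 2 = 0" "f (e 4) $ 3 = 0"
    "f (e 4) $ 4 = D * (u$0)^2"
    by (simp_all add: f4 L_nth f3_nth power2_eq_square)
  have f5_nth: "f (e 5) $ 0 = 0" "f (e 5) $ 1 = 0" "f (e 5) $ 2 = 0" "f (e 5) $ 3 = 0"
    "f (e 5) $ 4 = 0" "f (e 5) $ 5 = D * (u$0)^3"
    by (simp_all add: f5 L_nth f4_nth power2_eq_square power3_eq_cube)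
  have f6': "f (e 6) = (D * (u$0)^4) *s e 6"
    by (simp add: vec_7_eq_iff f6 L_nth e_nth f5_nth power3_eq_cube power4_eq_xxxx)
  have "f 0 = 0" using f_scale[of 0 0] by simp
  moreover have "e 6 \<noteq> 0" by (simp add: vec_7_eq_iff e_nth)
  ultimately have "f (e 6) \<noteq> 0"
    using bij by (metis bij_is_inj injD)
  then have D: "D \<noteq> 0" and u0: "u$0 \<noteq> 0" using f6' by auto
  have b12: "b12 *s f (e 6) = ?M v (f (e 2))"
    unfolding v_def hom[symmetric] basis f_scale ..
  \<comment> \<open>The \<open>e 3\<close>-coefficient is \<open>- v$0 * D\<close> on the right and
    0 on the left.\<close>
  have "v$0 * D = 0"
    using arg_cong[OF b12, of "\<lambda>x. x $ 3"] by (simp add: f6' L_nth e_nth f2_nth)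
  then have v0: "v$0 = 0" using D by simp
  then have D_eq: "D = v$1 * u$0" by (simp add: D_def)
  then have v1: "v$1 \<noteq> 0" using D by auto
  have "b00 *s f (e 6) = ?M u u" "b11 *s f (e 6) = ?M v v"
    unfolding u_def v_def hom[symmetric] basis f_scale by (rule refl)+
  moreover have "b01 *s f (e 6) = ?M u v + ?M v u"
    unfolding u_def v_def hom[symmetric] f_add[symmetric] basis_sym f_scale ..
  ultimately have
    b00: "b00 * (D * (u$0)^4) = c00 * (u$0)^2 + c01 * u$0 * u$1 + c11 * (u$1)^2" and
    b01: "b01 * (D * (u$0)^4) = v$1 * (c01 * u$0 + 2 * c11 * u$1)" and
    b11: "b11 * (D * (u$0)^4) = v$1 * (c11 * v$1)" and
    b12: "b12 * (D * (u$0)^4) = D * (c12 * v$1)"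
    using b12 unfolding f6' vec_7_eq_iff
    by (simp_all add: e_nth L_nth v0 f2_nth power2_eq_square algebra_simps)
  show ?thesis
  proof
    show "u$0 \<noteq> 0" "v$1 \<noteq> 0" by fact+
    show "b00 * (u$0)^5 * v$1 = c00 * (u$0)^2 + c01 * u$0 * u$1 + c11 * (u$1)^2"
      unfolding b00[symmetric] D_eq by (simp add: eval_nat_numeral)
    have "v$1 * (b01 * (u$0)^5) = v$1 * (c01 * u$0 + 2 * c11 * u$1)"
      unfolding b01[symmetric] D_eq by (simp add: eval_nat_numeral)
    then show "b01 * (u$0)^5 = c01 * u$0 + 2 * c11 * u$1" using v1 by simp
    have "v$1 * (b11 * (u$0)^5) = v$1 * (c11 * v$1)"
      unfolding b11[symmetric] D_eq by (simp add: eval_nat_numeral)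
    then show "b11 * (u$0)^5 = c11 * v$1" using v1 by simp
    show "b12 * (u$0)^4 = c12 * v$1" using b12 D by simp
  qed
qed

lemma params_imp_L_isomorphic:
  assumes "p \<noteq> 0" "r \<noteq> 0"
    and b00: "b00 * p^5 * r = c00 * p^2 + c01 * p * q + c11 * q^2"
    and b01: "b01 * p^5 = c01 * p + 2 * c11 * q"
    and b11: "b11 * p^5 = c11 * r" and b12: "b12 * p^4 = c12 * r"
  shows "leibniz_isomorphic (*s) (L b00 b01 b11 b12 0) (*s) (L c00 c01 c11 c12 0)"
proof -
  let ?L = "L b00 b01 b11 b12 0" and ?M = "L c00 c01 c11 c12 0"
  \<comment> \<open>Here \<open>e 0\<close> goes to \<open>u = p e 0 + q e 1\<close>,
    \<open>e 1\<close> to \<open>v = r e 1\<close>, and the rest is forced by iterated right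
    multiplication by \<open>u\<close>. The extra \<open>e 6\<close>-terms come from
    \<open>[v, u]\<close> (via \<open>c11\<close>) and \<open>[f (e 2), u]\<close> (via
    \<open>c12\<close>).\<close>
  define f :: "complex ^ 7 \<Rightarrow> complex ^ 7" where
    "f x = (p * x$0) *s e 0 + (q * x$0 + r * x$1) *s e 1 + (p * r * x$2) *s e 2
       + (p^2 * r * x$3) *s e 3 + (p^3 * r * x$4) *s e 4 + (p^4 * r * x$5) *s e 5
       + (p^5 * r * x$6 + c11 * q * r * x$2 - c12 * p * q * r * x$3) *s e 6" for x
  have f_nth: "f x $ 0 = p * x$0" "f x $ 1 = q * x$0 + r * x$1" "f x $ 2 = p * r * x$2"
    "f x $ 3 = p^2 * r * x$3" "f x $ 4 = p^3 * r * x$4" "f x $ 5 = p^4 * r * x$5"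
    "f x $ 6 = p^5 * r * x$6 + c11 * q * r * x$2 - c12 * p * q * r * x$3" for x
    by (simp_all add: f_def e_nth)
  have lin: "Vector_Spaces.linear (*s) (*s) f"
    by unfold_locales (simp_all add: vec_7_eq_iff f_nth algebra_simps)
  have inj: "inj f"
    by (rule injI) (use assms(1,2) in \<open>auto simp: vec_7_eq_iff f_nth\<close>)
  then have "bij f"
    using vec.linear_injective_imp_surjective[OF lin] by (simp add: bij_def)
  moreover have "f (?L x y) = ?M (f x) (f y)" for x y
  proof -
    \<comment> \<open>Only this coordinate involves the hypotheses. It is grouped so that their
      left-hand sides appear literally and can be rewritten.\<close>
    have "f (?L x y) $ 6 = p^5 * r * (x$5 * y$0 - x$0 * y$5)
        + (b00 * p^5 * r) * (x$0 * y$0) + r * (b01 * p^5) * (x$0 * y$1)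
        + r * (b11 * p^5) * (x$1 * y$1) + p * r * (b12 * p^4) * (x$1 * y$2 - x$2 * y$1)
        + c11 * q * r * (x$1 * y$0 - x$0 * y$1) - c12 * p * q * r * (x$2 * y$0 - x$0 * y$2)"
      by (simp add: f_nth L_nth algebra_simps eval_nat_numeral)
    also have "\<dots> = ?M (f x) (f y) $ 6"
      unfolding b00 b01 b11 b12 by (simp add: f_nth L_nth algebra_simps eval_nat_numeral)
    finally show ?thesis
      by (simp add: vec_7_eq_iff f_nth L_nth algebra_simps eval_nat_numeral)
  qed
  ultimately show ?thesis
    unfolding leibniz_isomorphic_def using leibniz_algebra_L lin by blast
qed

text \<open>The equations for \<open>b12\<close>, \<open>b11\<close> and \<open>b01\<close> fix
  \<open>p\<close>, \<open>r\<close> and \<open>q\<close> in turn; the one for \<open>b00\<close>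
  then amounts to the equality of discriminants \<open>p^8 Delta = Delta'\<close>.\<close>

lemma L_isomorphic_iff:
  assumes nz: "b11 \<noteq> 0" "b12 \<noteq> 0" "c11 \<noteq> 0" "c12 \<noteq> 0"
  shows "leibniz_isomorphic (*s) (L b00 b01 b11 b12 0) (*s) (L c00 c01 c11 c12 0) \<longleftrightarrow>
    (b12 / b11)^8 * Delta b00 b01 b11 = (c12 / c11)^8 * Delta c00 c01 c11"
    (is "?iso \<longleftrightarrow> ?inv")
proof
  assume ?iso
  then obtain p q r where p: "p \<noteq> 0" and r: "r \<noteq> 0"
    and b00: "b00 * p^5 * r = c00 * p^2 + c01 * p * q + c11 * q^2"
    and b01: "b01 * p^5 = c01 * p + 2 * c11 * q"
    and b11: "b11 * p^5 = c11 * r" and b12: "b12 * p^4 = c12 * r"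
    by (rule L_isomorphic_imp_params)
  \<comment> \<open>Both sides equal \<open>c11 * c12 * r^2\<close>.\<close>
  have "(b12 * c11 * r) * p^4 = (p * b11 * c12 * r) * p^4"
    using b11 b12 by algebra
  then have "b12 / b11 = p * (c12 / c11)"
    using nz p r by (simp add: field_simps)
  moreover have "p^8 * Delta b00 b01 b11 = Delta c00 c01 c11"
  proof -
    \<comment> \<open>Discriminants of both sides of the transformation law, with a common factor
      \<open>r\<close> removed; the substitution has determinant \<open>p * r\<close>.\<close>
    have "(p^2 * r) * (p^8 * Delta b00 b01 b11)
        = r * (b01 * p^5)^2 - 4 * (b00 * p^5 * r) * (b11 * p^5)"
      unfolding Delta_def by (simp add: algebra_simps eval_nat_numeral)
    also have "\<dots> = (p^2 * r) * Delta c00 c01 c11"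
      unfolding b00 b01 b11 Delta_def by (simp add: algebra_simps eval_nat_numeral)
    finally show ?thesis using p r by simp
  qed
  ultimately show ?inv by (metis power_mult_distrib mult.assoc mult.commute)
next
  assume inv: ?inv
  define p where "p = (b12 / b11) / (c12 / c11)"
  define r where "r = p^5 * b11 / c11"
  define q where "q = (b01 * p^5 - c01 * p) / (2 * c11)"
  have p: "p \<noteq> 0" and r: "r \<noteq> 0" using nz by (auto simp: p_def r_def)
  have b11: "b11 * p^5 = c11 * r" using nz by (simp add: r_def)
  have b01: "b01 * p^5 = c01 * p + 2 * c11 * q" using nz by (simp add: q_def)
  have b12: "b12 * p^4 = c12 * r"
  proof -
    have "b12 * c11 = p * b11 * c12" using nz by (simp add: p_def field_simps)
    then show ?thesis using nz by (simp add: r_def field_simps eval_nat_numeral)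
  qed
  have "p^8 * Delta b00 b01 b11 = Delta c00 c01 c11"
    using inv nz by (simp add: p_def power_divide field_simps)
  then have disc: "p^8 * (b01^2 - 4 * b00 * b11) = c01^2 - 4 * c00 * c11"
    by (simp add: Delta_def)
  \<comment> \<open>Completing the square: \<open>4 c11 (c00 p^2 + c01 p q + c11 q^2) = (c01 p + 2
    c11 q)^2 - p^2 Delta'\<close>.\<close>
  have "(4 * c11) * (b00 * p^5 * r) = 4 * b00 * p^5 * (b11 * p^5)"
    unfolding b11 by simp
  also have "\<dots> = (b01 * p^5)^2 - p^2 * (p^8 * (b01^2 - 4 * b00 * b11))"
    by (simp add: algebra_simps eval_nat_numeral)
  also have "\<dots> = (4 * c11) * (c00 * p^2 + c01 * p * q + c11 * q^2)"
    unfolding disc b01 by (simp add: algebra_simps eval_nat_numeral)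
  finally have "b00 * p^5 * r = c00 * p^2 + c01 * p * q + c11 * q^2" using nz by simp
  then show ?iso using p r b01 b11 b12 by (intro params_imp_L_isomorphic)
qed

theorem proposition3p10:
  shows
    "(\<forall>b00 b01 b11 b12 b14 b00' b01' b11' b12' b14'.
        L b00 b01 b11 b12 b14 \<in> U2 \<longrightarrow> L b00' b01' b11' b12' b14' \<in> U2 \<longrightarrow>
        (leibniz_isomorphic (*s) (L b00 b01 b11 b12 b14) (*s) (L b00' b01' b11' b12' b14') \<longleftrightarrow>
         (b12 / b11) ^ 8 * Delta b00 b01 b11 = (b12' / b11') ^ 8 * Delta b00' b01' b11'))
     \<and> (\<forall>l. \<exists>b00 b01 b11 b12 b14.
          L b00 b01 b11 b12 b14 \<in> U2 \<and> (b12 / b11) ^ 8 * Delta b00 b01 b11 = l)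
     \<and> (\<forall>A\<in>U2. \<exists>l. leibniz_isomorphic (*s) A (*s) (L l 0 1 1 0))"
proof (intro conjI allI impI ballI)
  fix b00 b01 b11 b12 b14 b00' b01' b11' b12' b14'
  assume "L b00 b01 b11 b12 b14 \<in> U2" "L b00' b01' b11' b12' b14' \<in> U2"
  then show "leibniz_isomorphic (*s) (L b00 b01 b11 b12 b14) (*s) (L b00' b01' b11' b12' b14') \<longleftrightarrow>
         (b12 / b11) ^ 8 * Delta b00 b01 b11 = (b12' / b11') ^ 8 * Delta b00' b01' b11'"
    by (simp add: L_in_U2_iff L_isomorphic_iff)
next
  fix l
  \<comment> \<open>The invariant of \<open>L b 0 1 1 0\<close> is \<open>-4 * b\<close>.\<close>
  have "L (- l / 4) 0 1 1 0 \<in> U2 \<and> (1 / 1) ^ 8 * Delta (- l / 4) 0 1 = l"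
    by (simp add: L_in_U2_iff Delta_def)
  then show "\<exists>b00 b01 b11 b12 b14.
      L b00 b01 b11 b12 b14 \<in> U2 \<and> (b12 / b11) ^ 8 * Delta b00 b01 b11 = l"
    by blast
next
  fix A
  assume "A \<in> U2"
  then obtain b00 b01 b11 b12 where A: "A = L b00 b01 b11 b12 0" and nz: "b11 \<noteq> 0" "b12 \<noteq> 0"
    unfolding U2_def by blast
  \<comment> \<open>The parameter is chosen so that the normal form has the same invariant as
    \<open>A\<close>.\<close>
  have "leibniz_isomorphic (*s) A (*s) (L (- ((b12 / b11) ^ 8 * Delta b00 b01 b11) / 4) 0 1 1 0)"
    unfolding A using nz by (subst L_isomorphic_iff) (simp_all add: Delta_def)
  then show "\<exists>l. leibniz_isomorphic (*s) A (*s) (L l 0 1 1 0)" by blast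
qed

end
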